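(* Let $\mathcal{I}$ be a finite parameter set and for every $\ell\in\mathbb{N}_0$ and $p\in\mathcal{I}$ let $A_\ell(p)$ be a real symmetric positive definite matrix with diagonal part $D_\ell(p)=\mathrm{diag}(A_\ell(p))$. Let the damping factor satisfy $\omega(p)\in\left(0,\rho\left(D_\ell^{-1}(p)A_\ell(p)\right)^{-1}\right]$, and let $S_{\mathrm{Jac},\omega,\ell}(p)=\mathrm{Id}-\omega(p)D_\ell^{-1}(p)A_\ell(p)$ be the iteration matrix of the damped Jacobi method. Then $$\left\lVert A_\ell(p)\,S_{\mathrm{Jac},\omega,\ell}^{\nu}(p)\right\rVert_2\le\frac{1}{2\omega(p)(\nu+1)}\,\lVert A_\ell(p)\rVert_2\qquad\text{for all }\nu\in\mathbb{N}$$ holds for all $p\in\mathcal{I}$ and $\ell\in\mathbb{N}_0$.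
   Context: $\mathbb{N}=\{1,2,\dots\}$, $\mathbb{N}_0=\mathbb{N}\cup\{0\}$. $\rho(\cdot)$ is the spectral radius and $\lVert\cdot\rVert_2$ the spectral norm. $A_\ell(p)$ is the system matrix on the grid of level $\ell$ for parameter $p$; $\mathrm{diag}(A)$ denotes the diagonal matrix with the same diagonal as $A$. The damped Jacobi method is the iteration $u_\ell^{j+1}(p)=u_\ell^j(p)+\omega(p)D_\ell^{-1}(p)\,(f_\ell-A_\ell(p)u_\ell^j(p))$ with damping factor $\omega(p)\in(0,1]$; $S^\nu$ denotes the $\nu$-th power of the iteration matrix. *)

theory Defs
  imports
    "Jordan_Normal_Form.Gauss_Jordan_Elimination"
    "Jordan_Normal_Form.Spectral_Radius"
begin

definition sym_pos_def_mat :: "real mat \<Rightarrow> bool" where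
  "sym_pos_def_mat A \<longleftrightarrow>
     square_mat A \<and> transpose_mat A = A \<and>
     (\<forall>x \<in> carrier_vec (dim_row A). x \<noteq> 0\<^sub>v (dim_row A) \<longrightarrow> 0 < x \<bullet> (A *\<^sub>v x))"

definition diag_part :: "real mat \<Rightarrow> real mat" where
  "diag_part A = mat_diag (dim_row A) (\<lambda>i. A $$ (i, i))"

(* Only meaningful for invertible matrices; mat_inverse returns None otherwise. *)
definition mat_inv :: "real mat \<Rightarrow> real mat" where
  "mat_inv A = the (mat_inverse A)"

(* The spectral radius is that of the complexified matrix: all complex eigenvalues count. *)
definition real_spectral_radius :: "real mat \<Rightarrow> real" where
  "real_spectral_radius A = spectral_radius (map_mat complex_of_real A)"

definition eucl_norm :: "real vec \<Rightarrow> real" where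
  "eucl_norm x = sqrt (x \<bullet> x)"

(* The operator norm induced by the Euclidean norm. As in the library's onorm, the zero vector
   stays in the index set: it contributes 0 / 0 = 0, which does not change the supremum of
   nonnegative quotients. *)
definition spectral_norm :: "real mat \<Rightarrow> real" where
  "spectral_norm A =
     (SUP x \<in> carrier_vec (dim_col A). eucl_norm (A *\<^sub>v x) / eucl_norm x)"

definition damped_jacobi :: "real \<Rightarrow> real mat \<Rightarrow> real mat" where
  "damped_jacobi \<omega> A = 1\<^sub>m (dim_row A) - \<omega> \<cdot>\<^sub>m (mat_inv (diag_part A) * A)"

end

(* With D the diagonal part of A, the matrix X = D^(-1/2) A D^(-1/2) is symmetric positive definite
   and similar to D^(-1) A, so its eigenvalues lie in (0, 1/omega]. Diagonalizing X orthogonally and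
   using A S^nu = D^(1/2) X (I - omega X)^nu D^(1/2), the bound reduces to
   t (1 - t)^nu <= 1 / (2 (nu + 1)) on [0, 1] and to the norm of D, which is at most that of A
   because the diagonal entries are Rayleigh quotients of A. *)
theory Submission
  imports Defs "HOL-Analysis.L2_Norm"
begin

section \<open>Euclidean norm and spectral norm\<close>

lemma eucl_norm_sum: "eucl_norm x = sqrt (\<Sum>i<dim_vec x. (x $ i)\<^sup>2)"
  unfolding eucl_norm_def scalar_prod_def by (simp add: power2_eq_square atLeast0LessThan)

lemma eucl_norm_nonneg [simp]: "0 \<le> eucl_norm x"
  by (simp add: eucl_norm_sum sum_nonneg)

lemma scalar_prod_self_nonneg: "0 \<le> (x :: real vec) \<bullet> x"
  unfolding scalar_prod_def by (simp add: sum_nonneg)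

lemma scalar_prod_self_pos:
  assumes "(x :: real vec) \<in> carrier_vec n" "x \<noteq> 0\<^sub>v n"
  shows "0 < x \<bullet> x"
proof -
  have "\<exists>i<n. x $ i \<noteq> 0"
  proof (rule ccontr)
    assume "\<not> ?thesis"
    with assms show False by (auto intro: eq_vecI)
  qed
  then obtain i where i: "i < n" "x $ i \<noteq> 0" by auto
  then have "0 < x $ i * x $ i" by (auto simp: zero_less_mult_iff)
  also have "\<dots> \<le> (\<Sum>i\<in>{0..<n}. x $ i * x $ i)"
    using i by (intro member_le_sum) auto
  finally show ?thesis using assms by (simp add: scalar_prod_def)
qed

text \<open>Cauchy-Schwarz, squared from its \<open>L2_set\<close> version so that no absolute
  values or roots remain.\<close>

lemma sum_mult_square_le:
  "(\<Sum>i\<in>I. a i * b i)\<^sup>2 \<le> (\<Sum>i\<in>I. (a i)\<^sup>2) * (\<Sum>i\<in>I. (b i)\<^sup>2)" for a b :: "'a \<Rightarrow> real"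
proof -
  have "\<bar>\<Sum>i\<in>I. a i * b i\<bar> \<le> (\<Sum>i\<in>I. \<bar>a i\<bar> * \<bar>b i\<bar>)"
    using sum_abs [of "\<lambda>i. a i * b i" I] by (simp add: abs_mult)
  also have "\<dots> \<le> L2_set a I * L2_set b I" by (rule L2_set_mult_ineq)
  finally have "\<bar>\<Sum>i\<in>I. a i * b i\<bar>\<^sup>2 \<le> (L2_set a I * L2_set b I)\<^sup>2" by (rule power_mono) simp
  then show ?thesis by (simp add: power_mult_distrib L2_set_def sum_nonneg)
qed

text \<open>The Frobenius norm serves as \<open>K\<close>. Only the existence of a finite bound
  matters: it makes the supremum in \<open>spectral_norm\<close> a genuine one.\<close>

lemma eucl_norm_mult_mat_vec_le:
  fixes A :: "real mat"
  obtains K where "\<And>x :: real vec. x \<in> carrier_vec (dim_col A) \<Longrightarrow> eucl_norm (A *\<^sub>v x) \<le> K * eucl_norm x" "0 \<le> K"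
proof
  let ?F = "\<Sum>i<dim_row A. \<Sum>j<dim_col A. (A $$ (i, j))\<^sup>2"
  show "0 \<le> sqrt ?F" by (simp add: sum_nonneg)
  fix x :: "real vec" assume x: "x \<in> carrier_vec (dim_col A)"
  \<comment> \<open>Cauchy-Schwarz is applied to each row of \<open>A\<close> separately.\<close>
  have "(\<Sum>i<dim_row A. ((A *\<^sub>v x) $ i)\<^sup>2) \<le>
      (\<Sum>i<dim_row A. (\<Sum>j<dim_col A. (A $$ (i, j))\<^sup>2) * (\<Sum>j<dim_col A. (x $ j)\<^sup>2))"
  proof (rule sum_mono)
    fix i assume "i \<in> {..<dim_row A}"
    then have "(A *\<^sub>v x) $ i = (\<Sum>j<dim_col A. A $$ (i, j) * x $ j)"
      using x by (auto simp: scalar_prod_def atLeast0LessThan)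
    then show "((A *\<^sub>v x) $ i)\<^sup>2 \<le> (\<Sum>j<dim_col A. (A $$ (i, j))\<^sup>2) * (\<Sum>j<dim_col A. (x $ j)\<^sup>2)"
      using sum_mult_square_le by metis
  qed
  also have "\<dots> = ?F * (\<Sum>j<dim_col A. (x $ j)\<^sup>2)" by (simp add: sum_distrib_right)
  finally show "eucl_norm (A *\<^sub>v x) \<le> sqrt ?F * eucl_norm x"
    using x by (simp add: eucl_norm_sum real_sqrt_mult [symmetric])
qed

text \<open>Dividing by \<open>eucl_norm x\<close> settles the vectors of positive norm. The zero
  vector contributes 0 / 0 = 0, which is where \<open>0 \<le> K\<close> enters.\<close>

lemma spectral_norm_le:
  assumes "0 \<le> K" "\<And>x. x \<in> carrier_vec (dim_col A) \<Longrightarrow> eucl_norm (A *\<^sub>v x) \<le> K * eucl_norm x"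
  shows "spectral_norm A \<le> K"
  unfolding spectral_norm_def
proof (rule cSUP_least)
  show "(carrier_vec (dim_col A) :: real vec set) \<noteq> {}" using zero_carrier_vec by blast
next
  fix x :: "real vec" assume "x \<in> carrier_vec (dim_col A)"
  then have "eucl_norm (A *\<^sub>v x) \<le> K * eucl_norm x" by (rule assms)
  then show "eucl_norm (A *\<^sub>v x) / eucl_norm x \<le> K"
    using assms(1) eucl_norm_nonneg [of x] by (auto simp: divide_simps not_less antisym_conv)
qed

lemma eucl_norm_mult_mat_vec_le_spectral_norm:
  assumes x: "x \<in> carrier_vec (dim_col A)"
  shows "eucl_norm (A *\<^sub>v x) / eucl_norm x \<le> spectral_norm A"
proof -
  obtain K where K: "\<And>x. x \<in> carrier_vec (dim_col A) \<Longrightarrow> eucl_norm (A *\<^sub>v x) \<le> K * eucl_norm x" "0 \<le> K"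
    by (rule eucl_norm_mult_mat_vec_le [of A]) blast
  have "bdd_above ((\<lambda>x. eucl_norm (A *\<^sub>v x) / eucl_norm x) ` carrier_vec (dim_col A))"
  proof (rule bdd_aboveI2)
    fix y :: "real vec" assume "y \<in> carrier_vec (dim_col A)"
    then show "eucl_norm (A *\<^sub>v y) / eucl_norm y \<le> K"
      using K(1) [of y] K(2) eucl_norm_nonneg [of y] by (auto simp: divide_simps not_less antisym_conv)
  qed
  with x show ?thesis unfolding spectral_norm_def by (rule cSUP_upper)
qed

text \<open>The zero vector belongs to the index set in every dimension, including 0, and its
  quotient is 0.\<close>

lemma spectral_norm_nonneg: "0 \<le> spectral_norm A"
proof -
  have "0 \<le> eucl_norm (A *\<^sub>v 0\<^sub>v (dim_col A)) / eucl_norm (0\<^sub>v (dim_col A))" by simp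
  also have "\<dots> \<le> spectral_norm A" by (intro eucl_norm_mult_mat_vec_le_spectral_norm) simp
  finally show ?thesis .
qed

text \<open>A diagonal entry is one coordinate of the image of a unit vector, and a coordinate never
  exceeds the Euclidean norm.\<close>

lemma diag_le_spectral_norm:
  assumes "A \<in> carrier_mat n n" "i < n"
  shows "A $$ (i, i) \<le> spectral_norm A"
proof -
  have e: "eucl_norm (unit_vec n i) = 1"
    using assms(2) by (simp add: eucl_norm_def)
  have "A $$ (i, i) = (A *\<^sub>v unit_vec n i) $ i" using assms by simp
  also have "\<dots> \<le> sqrt (((A *\<^sub>v unit_vec n i) $ i)\<^sup>2)" by simp
  also have "\<dots> \<le> eucl_norm (A *\<^sub>v unit_vec n i)"
    unfolding eucl_norm_sum using assms
    by (intro real_sqrt_le_mono member_le_sum [where f = "\<lambda>j. ((A *\<^sub>v unit_vec n i) $ j)\<^sup>2"]) auto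
  also have "\<dots> \<le> spectral_norm A"
    using assms eucl_norm_mult_mat_vec_le_spectral_norm [of "unit_vec n i" A] by (simp add: e)
  finally show ?thesis .
qed

lemma eucl_norm_mat_diag_le:
  assumes "x \<in> carrier_vec n" "\<And>i. i < n \<Longrightarrow> \<bar>g i\<bar> \<le> c" "0 \<le> c"
  shows "eucl_norm (mat_diag n g *\<^sub>v x) \<le> c * eucl_norm x"
proof -
  have ent: "(mat_diag n g *\<^sub>v x) $ i = g i * x $ i" if "i < n" for i
  proof -
    have "(mat_diag n g *\<^sub>v x) $ i = (\<Sum>j\<in>{0..<n}. if i = j then g j * x $ j else 0)"
      using that assms(1) by (subst index_mult_mat_vec) (simp_all add: scalar_prod_def mat_diag_def if_distrib [of "\<lambda>y. y * _"] cong: if_cong)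
    then show ?thesis using that by simp
  qed
  have d: "dim_vec (mat_diag n g *\<^sub>v x) = n" by (simp add: mat_diag_def)
  have "(g i * x $ i)\<^sup>2 \<le> c\<^sup>2 * (x $ i)\<^sup>2" if "i < n" for i
    using assms(2) [OF that] assms(3)
    by (auto simp: power_mult_distrib abs_le_square_iff [symmetric] intro!: mult_right_mono)
  then have "(\<Sum>i<n. ((mat_diag n g *\<^sub>v x) $ i)\<^sup>2) \<le> c\<^sup>2 * (\<Sum>i<n. (x $ i)\<^sup>2)"
    by (auto simp: ent sum_distrib_left intro!: sum_mono)
  then have "eucl_norm (mat_diag n g *\<^sub>v x) \<le> sqrt (c\<^sup>2 * (\<Sum>i<n. (x $ i)\<^sup>2))"
    unfolding eucl_norm_sum d by (rule real_sqrt_le_mono)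
  then show ?thesis using assms by (simp add: eucl_norm_sum real_sqrt_mult)
qed

section \<open>Orthogonal diagonalization of real symmetric matrices\<close>

lemma scalar_prod_mult_mat_vec:
  fixes A :: "'a :: comm_semiring_0 mat"
  assumes "A \<in> carrier_mat m n" "x \<in> carrier_vec m" "y \<in> carrier_vec n"
  shows "x \<bullet> (A *\<^sub>v y) = (A\<^sup>T *\<^sub>v x) \<bullet> y"
  using assms by (metis transpose_vec_mult_scalar)

lemma eucl_norm_isometry:
  assumes "P \<in> carrier_mat n n" "P\<^sup>T * P = 1\<^sub>m n" "x \<in> carrier_vec n"
  shows "eucl_norm (P *\<^sub>v x) = eucl_norm x"
proof -
  have "(P *\<^sub>v x) \<bullet> (P *\<^sub>v x) = (P\<^sup>T *\<^sub>v (P *\<^sub>v x)) \<bullet> x"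
    using assms by (intro scalar_prod_mult_mat_vec) auto
  also have "P\<^sup>T *\<^sub>v (P *\<^sub>v x) = x"
    using assms by (subst assoc_mult_mat_vec [symmetric, of _ n n _ n]) auto
  finally show ?thesis unfolding eucl_norm_def by simp
qed

text \<open>Real and imaginary part of a complex eigenvector are compared through the symmetric
  form; this kills the imaginary part of the eigenvalue.\<close>
lemma symmetric_mat_eigenvector_exists:
  assumes A: "(A :: real mat) \<in> carrier_mat n n" and sym: "A\<^sup>T = A" and n: "0 < n"
  obtains v e where "v \<in> carrier_vec n" "A *\<^sub>v v = e \<cdot>\<^sub>v v" "v \<bullet> v = 1"
proof -
  let ?C = "map_mat complex_of_real A"
  have C: "?C \<in> carrier_mat n n" using A by simp
  \<comment> \<open>For \<open>0 < n\<close> the spectral radius is attained, so the complex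
    spectrum is nonempty.\<close>
  obtain ev where "ev \<in> spectrum ?C" using spectral_radius_mem_max(1) [OF C n] by auto
  then obtain w where w: "w \<in> carrier_vec n" "w \<noteq> 0\<^sub>v n" and ev: "?C *\<^sub>v w = ev \<cdot>\<^sub>v w"
    using C by (auto simp: spectrum_def eigenvalue_def eigenvector_def)
  define a where "a = map_vec Re w"
  define b where "b = map_vec Im w"
  have ab: "a \<in> carrier_vec n" "b \<in> carrier_vec n" using w by (auto simp: a_def b_def)
  have entry: "(\<Sum>j\<in>{0..<n}. complex_of_real (A $$ (i, j)) * w $ j) = ev * w $ i" if "i < n" for i
  proof -
    have "(?C *\<^sub>v w) $ i = (ev \<cdot>\<^sub>v w) $ i" using ev by simp
    then show ?thesis using that A w by (auto simp: scalar_prod_def)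
  qed
  \<comment> \<open>This identity and \<open>Ab\<close> below are the real and the imaginary part of
    the complex eigenvector equation.\<close>
  have Aa: "A *\<^sub>v a = Re ev \<cdot>\<^sub>v a - Im ev \<cdot>\<^sub>v b"
  proof (rule eq_vecI)
    show "(A *\<^sub>v a) $ i = (Re ev \<cdot>\<^sub>v a - Im ev \<cdot>\<^sub>v b) $ i" if "i < dim_vec (Re ev \<cdot>\<^sub>v a - Im ev \<cdot>\<^sub>v b)" for i
      using that arg_cong [OF entry [of i], of Re] A w by (auto simp: scalar_prod_def a_def b_def)
  qed (use A ab in auto)
  have Ab: "A *\<^sub>v b = Im ev \<cdot>\<^sub>v a + Re ev \<cdot>\<^sub>v b"
  proof (rule eq_vecI)
    show "(A *\<^sub>v b) $ i = (Im ev \<cdot>\<^sub>v a + Re ev \<cdot>\<^sub>v b) $ i" if "i < dim_vec (Im ev \<cdot>\<^sub>v a + Re ev \<cdot>\<^sub>v b)" for i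
      using that arg_cong [OF entry [of i], of Im] A w by (auto simp: scalar_prod_def a_def b_def)
  qed (use A ab in auto)
  have nz: "a \<noteq> 0\<^sub>v n \<or> b \<noteq> 0\<^sub>v n"
  proof (rule ccontr)
    assume "\<not> ?thesis"
    then have "a $ i = 0 \<and> b $ i = 0" if "i < n" for i using that by simp
    then have "w = 0\<^sub>v n" using w by (intro eq_vecI) (auto simp: a_def b_def complex_eq_iff)
    with w show False by simp
  qed
  have "b \<bullet> (A *\<^sub>v a) = (A *\<^sub>v b) \<bullet> a"
    using scalar_prod_mult_mat_vec [OF A ab(2,1)] sym by simp
  moreover have "b \<bullet> (A *\<^sub>v a) = Re ev * (b \<bullet> a) - Im ev * (b \<bullet> b)"
    unfolding Aa using ab by (subst scalar_prod_minus_distrib [of _ n]) auto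
  moreover have "(A *\<^sub>v b) \<bullet> a = Im ev * (a \<bullet> a) + Re ev * (b \<bullet> a)"
    unfolding Ab using ab by (subst add_scalar_prod_distrib [of _ n]) auto
  ultimately have "Im ev * (a \<bullet> a + b \<bullet> b) = 0" by (simp add: algebra_simps)
  moreover have "a \<bullet> a + b \<bullet> b > 0"
    using nz scalar_prod_self_pos [OF ab(1)] scalar_prod_self_pos [OF ab(2)]
      scalar_prod_self_nonneg [of a] scalar_prod_self_nonneg [of b] by fastforce
  ultimately have im: "Im ev = 0" by simp
  \<comment> \<open>With \<open>Im ev = 0\<close> both \<open>a\<close> and \<open>b\<close> satisfy
    the eigenvector equation for \<open>Re ev\<close>, and at least one of them is nonzero.\<close>
  have "\<exists>u\<in>carrier_vec n. u \<noteq> 0\<^sub>v n \<and> A *\<^sub>v u = Re ev \<cdot>\<^sub>v u"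
  proof -
    have "A *\<^sub>v a = Re ev \<cdot>\<^sub>v a" "A *\<^sub>v b = Re ev \<cdot>\<^sub>v b"
      using ab unfolding Aa Ab im by auto
    then show ?thesis using nz ab by blast
  qed
  then obtain u where u: "u \<in> carrier_vec n" "u \<noteq> 0\<^sub>v n" "A *\<^sub>v u = Re ev \<cdot>\<^sub>v u" by auto
  have pos: "0 < u \<bullet> u" using scalar_prod_self_pos u by blast
  show thesis
  proof (rule that)
    let ?s = "1 / sqrt (u \<bullet> u)"
    show "?s \<cdot>\<^sub>v u \<in> carrier_vec n" using u by simp
    show "A *\<^sub>v (?s \<cdot>\<^sub>v u) = Re ev \<cdot>\<^sub>v (?s \<cdot>\<^sub>v u)"
      using u A by (simp add: mult_mat_vec smult_smult_assoc mult.commute)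
    show "(?s \<cdot>\<^sub>v u) \<bullet> (?s \<cdot>\<^sub>v u) = 1" using u pos by (simp add: field_simps)
  qed
qed

text \<open>The witness is the Householder reflection along \<open>v - e\<^sub>0\<close>.\<close>
lemma householder_exists:
  assumes v: "(v :: real vec) \<in> carrier_vec n" "v \<bullet> v = 1" and n: "0 < n"
  obtains H where "H \<in> carrier_mat n n" "H\<^sup>T = H" "H * H = 1\<^sub>m n" "H *\<^sub>v unit_vec n 0 = v"
proof -
  define u where "u i = v $ i - (if i = 0 then 1 else 0)" for i
  define q where "q = (\<Sum>k<n. u k * u k)"
  \<comment> \<open>The usual factor of a reflection along \<open>u\<close>. If \<open>v\<close>
    already is the first unit vector, then \<open>q = 0\<close>, division by zero gives
    \<open>c = 0\<close>, and \<open>H\<close> is the identity.\<close>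
  define c where "c = 2 / q"
  define H where "H = mat n n (\<lambda>(i, j). (if i = j then 1 else 0) - c * u i * u j)"
  have vv: "(\<Sum>k<n. v $ k * v $ k) = 1"
    using v by (simp add: scalar_prod_def atLeast0LessThan)
  have "u k * u k = v $ k * v $ k + (if k = 0 then 1 - 2 * v $ 0 else 0)" for k
    by (auto simp: u_def algebra_simps)
  \<comment> \<open>Since \<open>v\<close> has norm 1, this says \<open>q = - 2 * u 0\<close>. Hence
    \<open>c * u 0 = - 1\<close> for nonzero \<open>q\<close>, and the first column of
    \<open>H\<close> becomes \<open>v\<close>.\<close>
  then have q: "q = 2 - 2 * v $ 0"
    using n by (simp add: q_def sum.distrib vv)
  \<comment> \<open>True for \<open>q = 0\<close> as well, because then \<open>c = 0\<close>. It
    lets the quadratic term of \<open>H * H\<close> cancel the linear one.\<close>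
  have cq: "c * c * q = 2 * c" by (simp add: c_def)
  have uz: "u i = 0" if "q = 0" "i < n" for i
    using that unfolding q_def by (subst (asm) sum_nonneg_eq_0_iff) auto
  show thesis
  proof (rule that [of H])
    show H: "H \<in> carrier_mat n n" by (simp add: H_def)
    show "H\<^sup>T = H" by (auto simp: H_def)
    show "H * H = 1\<^sub>m n"
    proof (rule eq_matI)
      fix i j assume "i < dim_row (1\<^sub>m n :: real mat)" "j < dim_col (1\<^sub>m n :: real mat)"
      then have ij: "i < n" "j < n" by auto
      have "(H * H) $$ (i, j) = (\<Sum>k<n. ((if i = k then 1 else 0) - c * u i * u k) * ((if k = j then 1 else 0) - c * u k * u j))"
        using ij by (simp add: H_def scalar_prod_def atLeast0LessThan)
      \<comment> \<open>The Kronecker deltas are separated: their sums collapse to single terms, and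
        the remaining sum is a multiple of \<open>q\<close>.\<close>
      also have "\<dots> = (\<Sum>k<n. (if k = i then (if i = j then 1 else 0) - c * u i * u j else 0)
            - (if k = j then c * u i * u j else 0) + c * c * u i * u j * (u k * u k))"
        by (intro sum.cong) (auto simp: algebra_simps)
      also have "\<dots> = (if i = j then 1 else 0) - 2 * c * u i * u j + c * c * u i * u j * q"
        using ij by (simp add: sum.distrib sum_subtractf q_def sum_distrib_left)
      also have "c * c * u i * u j * q = 2 * c * u i * u j"
        using cq by (metis mult.assoc mult.commute)
      finally show "(H * H) $$ (i, j) = 1\<^sub>m n $$ (i, j)" using ij by simp
    qed (simp_all add: H_def)
    show "H *\<^sub>v unit_vec n 0 = v"
    proof (rule eq_vecI)
      fix i assume "i < dim_vec v"
      then have i: "i < n" using v by simp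
      have "(H *\<^sub>v unit_vec n 0) $ i = (if i = 0 then 1 else 0) - c * u i * u 0"
        using i n by (simp add: H_def)
      also have "\<dots> = v $ i"
      proof (cases "q = 0")
        case True
        with uz [OF True i] show ?thesis by (simp add: u_def)
      next
        case False
        then have "c * u 0 = - 1" unfolding c_def q by (simp add: u_def field_simps)
        then have "c * u i * u 0 = - u i" by (metis mult.assoc mult.commute mult_minus1)
        then show ?thesis by (simp add: u_def)
      qed
      finally show "(H *\<^sub>v unit_vec n 0) $ i = v $ i" .
    qed (use v in \<open>simp add: H_def\<close>)
  qed
qed

text \<open>Induction by deflation: a reflection moves a unit eigenvector to the first axis,
  symmetry splits off a 1 by 1 block, and the induction hypothesis handles the other block.\<close>

lemma symmetric_mat_diagonalization:
  assumes "(A :: real mat) \<in> carrier_mat n n" "A\<^sup>T = A"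
  shows "\<exists>P f. P \<in> carrier_mat n n \<and> P\<^sup>T * P = 1\<^sub>m n \<and> P * P\<^sup>T = 1\<^sub>m n \<and> A = P * mat_diag n f * P\<^sup>T"
  using assms
proof (induction n arbitrary: A)
  case 0
  show ?case
    using 0 by (intro exI [of _ "1\<^sub>m 0"] exI [of _ "\<lambda>_. 0"]) auto
next
  case (Suc n)
  let ?N = "Suc n"
  note assoc = assoc_mult_mat [of _ ?N ?N _ ?N _ ?N]
  obtain v e where v: "v \<in> carrier_vec ?N" "A *\<^sub>v v = e \<cdot>\<^sub>v v" "v \<bullet> v = 1"
    by (rule symmetric_mat_eigenvector_exists [OF Suc.prems]) auto
  obtain H where H: "H \<in> carrier_mat ?N ?N" "H\<^sup>T = H" "H * H = 1\<^sub>m ?N" "H *\<^sub>v unit_vec ?N 0 = v"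
    by (rule householder_exists [OF v(1,3)]) auto
  have HH: "H * (H * M) = M" if "M \<in> carrier_mat ?N ?N" for M
    using that H by (simp add: assoc [symmetric])
  \<comment> \<open>As \<open>H\<close> is its own inverse and transpose, \<open>B\<close> is
    \<open>A\<close> in the reflected basis and stays symmetric.\<close>
  define B where "B = H * (A * H)"
  have B: "B \<in> carrier_mat ?N ?N" using H Suc.prems by (simp add: B_def)
  have AB: "A = H * B * H"
    using H Suc.prems by (simp add: B_def assoc HH)
  have Bsym: "B\<^sup>T = B"
    using H Suc.prems by (simp add: B_def transpose_mult [of _ ?N ?N _ ?N] assoc)
  have Hv: "H *\<^sub>v v = unit_vec ?N 0"
    using H(1,3) by (simp add: H(4) [symmetric] assoc_mult_mat_vec [of _ ?N ?N _ ?N, symmetric])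
  have "B *\<^sub>v unit_vec ?N 0 = H *\<^sub>v (A *\<^sub>v (H *\<^sub>v unit_vec ?N 0))"
    unfolding B_def using H(1) Suc.prems by (simp add: assoc_mult_mat_vec [of _ ?N ?N _ ?N])
  also have "\<dots> = e \<cdot>\<^sub>v unit_vec ?N 0"
    using H(1) v(1) by (simp add: H(4) v(2) mult_mat_vec Hv)
  finally have Be: "B *\<^sub>v unit_vec ?N 0 = e \<cdot>\<^sub>v unit_vec ?N 0" .
  \<comment> \<open>The first column is a multiple of the first unit vector. Symmetry carries this
    over to the first row, so \<open>B\<close> is block diagonal.\<close>
  have col0: "B $$ (i, 0) = (if i = 0 then e else 0)" if "i < ?N" for i
    using arg_cong [OF Be, of "\<lambda>x. x $ i"] that B by auto
  have row0: "B $$ (0, i) = (if i = 0 then e else 0)" if "i < ?N" for i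
    using col0 [OF that] that B arg_cong [OF Bsym, of "\<lambda>M. M $$ (i, 0)"] by simp
  define C where "C = mat n n (\<lambda>(i, j). B $$ (Suc i, Suc j))"
  have C: "C \<in> carrier_mat n n" by (simp add: C_def)
  have Csym: "C\<^sup>T = C"
  proof (rule eq_matI)
    show "C\<^sup>T $$ (i, j) = C $$ (i, j)" if "i < dim_row C" "j < dim_col C" for i j
      using that B arg_cong [OF Bsym, of "\<lambda>M. M $$ (Suc i, Suc j)"] by (simp add: C_def)
  qed (simp_all add: C_def)
  obtain Q f where Q: "Q \<in> carrier_mat n n" "Q\<^sup>T * Q = 1\<^sub>m n" "Q * Q\<^sup>T = 1\<^sub>m n" "C = Q * mat_diag n f * Q\<^sup>T"
    using Suc.IH [OF C Csym] by blast
  let ?z = "0\<^sub>m 1 n :: real mat" and ?z' = "0\<^sub>m n 1 :: real mat"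
  \<comment> \<open>\<open>G\<close> extends \<open>Q\<close> by a fixed first axis, and
    \<open>g\<close> puts the eigenvalue \<open>e\<close> in front of those of the smaller
    block.\<close>
  define G where "G = four_block_mat (1\<^sub>m 1) ?z ?z' Q"
  define g where "g i = (case i of 0 \<Rightarrow> e | Suc j \<Rightarrow> f j)" for i
  have G: "G \<in> carrier_mat ?N ?N" using four_block_carrier_mat [of "1\<^sub>m 1" 1 1 Q n n] Q(1) by (simp add: G_def)
  have GT: "G\<^sup>T = four_block_mat (1\<^sub>m 1) ?z ?z' Q\<^sup>T"
    unfolding G_def using Q by (subst transpose_four_block_mat [of _ 1 1 _ n _ n]) auto
  have g: "mat_diag ?N g = four_block_mat (mat_diag 1 (\<lambda>_. e)) ?z ?z' (mat_diag n f)"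
    by (rule eq_matI) (auto simp: mat_diag_def g_def split: nat.split)
  have Bblock: "B = four_block_mat (mat_diag 1 (\<lambda>_. e)) ?z ?z' C"
  proof (rule eq_matI)
    fix i j assume "i < dim_row (four_block_mat (mat_diag 1 (\<lambda>_. e)) ?z ?z' C)"
      "j < dim_col (four_block_mat (mat_diag 1 (\<lambda>_. e)) ?z ?z' C)"
    then have "i < ?N" "j < ?N" using C by (auto simp: mat_diag_def)
    then show "B $$ (i, j) = four_block_mat (mat_diag 1 (\<lambda>_. e)) ?z ?z' C $$ (i, j)"
      using col0 [of i] row0 [of j] by (cases i; cases j) (auto simp: mat_diag_def C_def)
  qed (use B C in \<open>auto simp: mat_diag_def\<close>)
  note mult_block = mult_four_block_mat [of _ 1 1 _ n _ n _ _ 1 _ n]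
  have GTG: "G\<^sup>T * G = 1\<^sub>m ?N"
    unfolding GT unfolding G_def using Q by (subst mult_block) auto
  have GGT: "G * G\<^sup>T = 1\<^sub>m ?N"
    unfolding GT unfolding G_def using Q by (subst mult_block) auto
  have "G * mat_diag ?N g = four_block_mat (mat_diag 1 (\<lambda>_. e)) ?z ?z' (Q * mat_diag n f)"
    unfolding g unfolding G_def using Q
    by (subst mult_block) (auto simp: left_mult_zero_mat [OF mat_diag_dim] left_mult_one_mat [OF mat_diag_dim])
  moreover have QF: "Q * mat_diag n f \<in> carrier_mat n n" "Q * mat_diag n f * Q\<^sup>T \<in> carrier_mat n n"
    using Q(1) by (auto intro!: mult_carrier_mat [of _ n n])
  ultimately have BG: "B = G * mat_diag ?N g * G\<^sup>T"
    unfolding GT Bblock using Q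
    by (simp only:, subst mult_block) (auto simp: QF left_add_zero_mat [OF QF(2)] right_mult_zero_mat [OF QF(1)]
        right_mult_zero_mat [OF mat_diag_dim] right_mult_one_mat [OF mat_diag_dim])
  show ?case
  proof (intro exI conjI)
    have T: "(H * G)\<^sup>T = G\<^sup>T * H" using H G by (simp add: transpose_mult [of _ ?N ?N _ ?N])
    \<comment> \<open>The orthogonal factor for \<open>A\<close> combines both changes of basis:
      \<open>A = H * B * H\<close>, and \<open>G\<close> diagonalizes \<open>B\<close>.\<close>
    show "H * G \<in> carrier_mat ?N ?N" using H G by simp
    show "(H * G)\<^sup>T * (H * G) = 1\<^sub>m ?N"
      unfolding T using H G GTG by (simp add: assoc HH)
    define M where "M = mat_diag ?N g"
    have M: "M \<in> carrier_mat ?N ?N" by (simp add: M_def)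
    have "G * (G\<^sup>T * H) = H" using H G GGT by (simp add: assoc [symmetric])
    then show "H * G * (H * G)\<^sup>T = 1\<^sub>m ?N"
      unfolding T using H G by (simp add: assoc)
    show "A = H * G * mat_diag ?N g * (H * G)\<^sup>T"
      unfolding T AB BG M_def [symmetric] using H G M by (simp add: assoc)
  qed
qed

section \<open>The scalar estimate\<close>

text \<open>The bound on \<open>t * (1 - t) ^ \<nu>\<close> takes this form under
  \<open>s = t / (1 - t)\<close> and \<open>n = \<nu> + 1\<close>; the binomial expansion up to
  second order suffices. For \<open>n = 1\<close> it would fail at every
  \<open>s > 1\<close>.\<close>

lemma two_mult_le_one_plus_power:
  fixes s :: real
  assumes "0 \<le> s" "2 \<le> n"
  shows "2 * real n * s \<le> (1 + s) ^ n"
proof -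
  \<comment> \<open>Bernoulli's inequality with the quadratic binomial term kept. The induction step
    leaves a cubic remainder, which is nonnegative.\<close>
  have quad: "1 + real k * s + real k * (real k - 1) / 2 * s\<^sup>2 \<le> (1 + s) ^ k" for k
  proof (induction k)
    case (Suc k)
    have "0 \<le> real k * (real k - 1)" by (cases k) auto
    then have "0 \<le> real k * (real k - 1) / 2 * s ^ 3" using assms by simp
    moreover have "(1 + s) * (1 + real k * s + real k * (real k - 1) / 2 * s\<^sup>2) \<le> (1 + s) ^ Suc k"
      using Suc assms by (simp add: mult_left_mono)
    moreover have "(1 + s) * (1 + real k * s + real k * (real k - 1) / 2 * s\<^sup>2)
        = 1 + real (Suc k) * s + real (Suc k) * (real (Suc k) - 1) / 2 * s\<^sup>2 + real k * (real k - 1) / 2 * s ^ 3"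
      by (simp add: field_simps power2_eq_square power3_eq_cube)
    ultimately show ?case by linarith
  qed simp
  have n: "2 \<le> real n" using assms by simp
  \<comment> \<open>Four times the gap \<open>1 - n * s + n * (n - 1) / 2 * s\<^sup>2\<close>,
    written as a square plus a term that is nonnegative because \<open>2 \<le> n\<close>.\<close>
  have "0 \<le> (real n * s - 2)\<^sup>2 + real n * (real n - 2) * s\<^sup>2"
    using n by simp
  also have "\<dots> = 2 * (2 - 2 * real n * s + real n * (real n - 1) * s\<^sup>2)"
    by (simp add: field_simps power2_eq_square)
  finally have "0 \<le> 1 - real n * s + real n * (real n - 1) / 2 * s\<^sup>2" by simp
  with quad [of n] show ?thesis by simp
qed

text \<open>Substituting \<open>s = t / (1 - t)\<close> reduces this to the preceding inequality.
  The constant 1/2 needs at least one smoothing step: for \<open>\<nu> = 0\<close> and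
  \<open>t = 1\<close> the bound is false.\<close>

lemma mult_one_minus_power_le:
  fixes t :: real
  assumes "0 \<le> t" "t \<le> 1" "1 \<le> \<nu>"
  shows "t * (1 - t) ^ \<nu> \<le> 1 / (2 * (real \<nu> + 1))"
proof (cases "t = 1")
  case False
  then have t: "0 < 1 - t" using assms by simp
  define s where "s = t / (1 - t)"
  have s: "1 + s = 1 / (1 - t)" "0 \<le> s" using t assms by (auto simp: s_def field_simps)
  have "2 * real (Suc \<nu>) * s \<le> (1 + s) ^ Suc \<nu>" using s assms by (intro two_mult_le_one_plus_power) auto
  then have "2 * real (Suc \<nu>) * (t / (1 - t)) \<le> 1 / (1 - t) ^ Suc \<nu>"
    unfolding s by (simp add: s_def power_divide)
  then have "2 * real (Suc \<nu>) * (t / (1 - t)) * (1 - t) ^ Suc \<nu> \<le> 1"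
    using t by (simp add: pos_le_divide_eq)
  also have "2 * real (Suc \<nu>) * (t / (1 - t)) * (1 - t) ^ Suc \<nu> = t * (1 - t) ^ \<nu> * (2 * (real \<nu> + 1))"
    using t by simp
  finally show ?thesis by (subst pos_le_divide_eq) auto
\<comment> \<open>At \<open>t = 1\<close>, where the substitution breaks down, the left-hand side
  vanishes because \<nu> is positive.\<close>
qed (use assms in \<open>auto simp: power_0_left\<close>)

section \<open>Diagonal matrices, positive definiteness and the change of basis\<close>

text \<open>\<open>mat_inv\<close> unwraps an option, so membership in the units of the matrix ring
  is shown first to exclude \<open>None\<close>. Uniqueness of the inverse then identifies the
  result.\<close>

lemma mat_inv_mat_diag:
  assumes "\<And>i. i < n \<Longrightarrow> d i \<noteq> 0"
  shows "mat_inv (mat_diag n d) = mat_diag n (\<lambda>i. 1 / d i)"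
proof -
  let ?D = "mat_diag n d" and ?E = "mat_diag n (\<lambda>i. 1 / d i)"
  have DE: "?D * ?E = 1\<^sub>m n" "?E * ?D = 1\<^sub>m n"
    unfolding mat_diag_diag using assms by (auto simp: mat_diag_def intro!: eq_matI)
  have "?D \<in> Units (ring_mat TYPE(real) n ())"
    using DE unfolding Units_def ring_mat_def by (auto intro!: bexI [of _ ?E])
  then obtain B where B: "mat_inverse ?D = Some B"
    using mat_inverse(1) [of ?D n "()"] by (cases "mat_inverse ?D") auto
  from mat_inverse(2) [OF mat_diag_dim B]
  have B': "B * ?D = 1\<^sub>m n" "B \<in> carrier_mat n n" by auto
  have "B = B * (?D * ?E)" using B' DE by simp
  also have "\<dots> = ?E"
    by (simp only: assoc_mult_mat [OF B'(2) mat_diag_dim mat_diag_dim, symmetric] B'(1)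
        left_mult_one_mat [OF mat_diag_dim])
  finally show ?thesis using B by (simp add: mat_inv_def)
qed

lemma mat_diag_power:
  fixes f :: "nat \<Rightarrow> 'a :: comm_semiring_1"
  shows "mat_diag n f ^\<^sub>m k = mat_diag n (\<lambda>i. f i ^ k)"
proof (induction k)
  case 0
  show ?case by (simp add: mat_diag_def)
next
  case (Suc k)
  then show ?case by (simp add: mult.commute)
qed

lemma transpose_mat_diag [simp]: "(mat_diag n f)\<^sup>T = mat_diag n f"
  by (rule eq_matI) (auto simp: mat_diag_def)

lemma sym_pos_def_matD:
  assumes "sym_pos_def_mat A" "A \<in> carrier_mat n n" "x \<in> carrier_vec n" "x \<noteq> 0\<^sub>v n"
  shows "0 < x \<bullet> (A *\<^sub>v x)"
  using assms unfolding sym_pos_def_mat_def by (metis carrier_matD(1))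

text \<open>Diagonal entries are values of the quadratic form at unit vectors. Their positivity
  makes the diagonal part invertible and gives it a real square root.\<close>

lemma sym_pos_def_mat_diag_pos:
  assumes "sym_pos_def_mat A" and A: "A \<in> carrier_mat n n" and i: "i < n"
  shows "0 < A $$ (i, i)"
proof -
  let ?e = "unit_vec n i :: real vec"
  have "?e \<noteq> 0\<^sub>v n"
    using i by (metis index_unit_vec(2) index_zero_vec(1) zero_neq_one)
  then have "0 < ?e \<bullet> (A *\<^sub>v ?e)" using assms by (intro sym_pos_def_matD) auto
  also have "?e \<bullet> (A *\<^sub>v ?e) = (A *\<^sub>v ?e) $ i"
    by (rule scalar_prod_left_unit [OF mult_mat_vec_carrier [OF A unit_vec_carrier] i])
  finally show ?thesis using A i by simp
qed

text \<open>Take \<open>W = P\<^sup>T D^(1/2)\<close>, where \<open>P\<close> diagonalizes \<open>D^(-1/2) A D^(-1/2)\<close> orthogonally.\<close>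
lemma simultaneous_diagonalization:
  assumes spd: "sym_pos_def_mat A" and A: "A \<in> carrier_mat n n"
  obtains V W f where "V \<in> carrier_mat n n" "W \<in> carrier_mat n n" "V * W = 1\<^sub>m n" "W * V = 1\<^sub>m n"
    "A = W\<^sup>T * mat_diag n f * W" "mat_inv (diag_part A) * A = V * mat_diag n f * W"
    "\<And>x. x \<in> carrier_vec n \<Longrightarrow> eucl_norm (W *\<^sub>v x) \<le> sqrt (spectral_norm A) * eucl_norm x"
    "\<And>x. x \<in> carrier_vec n \<Longrightarrow> eucl_norm (W\<^sup>T *\<^sub>v x) \<le> sqrt (spectral_norm A) * eucl_norm x"
proof -
  note assoc = assoc_mult_mat [of _ n n _ n _ n]
  note transpose = transpose_mult [of _ n n _ n]
  define d where "d i = A $$ (i, i)" for i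
  have d: "0 < d i" if "i < n" for i
    using sym_pos_def_mat_diag_pos [OF spd A that] by (simp add: d_def)
  have "diag_part A = mat_diag n d" using A by (simp add: diag_part_def d_def [abs_def])
  then have diag: "mat_inv (diag_part A) = mat_diag n (\<lambda>i. 1 / d i)"
    using mat_inv_mat_diag [of n d] d by (metis less_irrefl)
  have Asym: "A\<^sup>T = A" using spd by (simp add: sym_pos_def_mat_def)
  define R where "R = mat_diag n (\<lambda>i. sqrt (d i))"
  define R' where "R' = mat_diag n (\<lambda>i. 1 / sqrt (d i))"
  have R: "R \<in> carrier_mat n n" "R' \<in> carrier_mat n n" by (auto simp: R_def R'_def)
  have RR: "R * R' = 1\<^sub>m n" "R' * R = 1\<^sub>m n"
    unfolding R_def R'_def mat_diag_diag using d by (auto simp: mat_diag_def less_imp_neq [symmetric] intro!: eq_matI)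
  have RR1: "R * (R' * M) = M" "R' * (R * M) = M" if "M \<in> carrier_mat n n" for M
    using that R RR by (simp_all add: assoc [symmetric])
  have RT: "R\<^sup>T = R" "R'\<^sup>T = R'" by (simp_all add: R_def R'_def)
  have R'R': "mat_inv (diag_part A) = R' * R'"
    unfolding diag R'_def mat_diag_diag using d by (auto simp: mat_diag_def less_imp_le intro!: eq_matI)
  \<comment> \<open>Unlike D^(-1) A, this matrix is symmetric, so orthogonal diagonalization
    applies; \<open>R' * X * R\<close> is D^(-1) A again.\<close>
  define X where "X = R' * (A * R')"
  have X: "X \<in> carrier_mat n n" using R A by (simp add: X_def)
  have "X\<^sup>T = X" using R A by (simp add: X_def transpose RT Asym assoc)
  with symmetric_mat_diagonalization [OF X] obtain P f where
    P: "P \<in> carrier_mat n n" "P\<^sup>T * P = 1\<^sub>m n" "P * P\<^sup>T = 1\<^sub>m n" and XP: "X = P * mat_diag n f * P\<^sup>T"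
    by blast
  have PT: "P\<^sup>T \<in> carrier_mat n n" using P by simp
  define F where "F = mat_diag n f"
  have F: "F \<in> carrier_mat n n" by (simp add: F_def)
  have P1: "P * (P\<^sup>T * M) = M" "P\<^sup>T * (P * M) = M" if "M \<in> carrier_mat n n" for M
    using that P PT by (simp_all add: assoc [symmetric])
  have AX: "A = R * (X * R)"
    using R A RR by (simp add: X_def assoc RR1)
  \<comment> \<open>The entries of D are at most the spectral norm of \<open>A\<close>, so D^(1/2)
    stretches vectors by at most the square root of that norm.\<close>
  have r: "\<bar>sqrt (d i)\<bar> \<le> sqrt (spectral_norm A)" if "i < n" for i
    using diag_le_spectral_norm [OF A that] d [OF that] by (simp add: d_def)
  have Rle: "eucl_norm (R *\<^sub>v x) \<le> sqrt (spectral_norm A) * eucl_norm x" if "x \<in> carrier_vec n" for x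
    unfolding R_def
    by (rule eucl_norm_mat_diag_le [OF that r]) (simp_all add: spectral_norm_nonneg)
  show thesis
  \<comment> \<open>With \<open>V = R' * P\<close> and \<open>W = P\<^sup>T * R\<close>, one
    diagonal matrix represents \<open>A\<close> by congruence and D^(-1) A by similarity.\<close>
  proof (rule that [of "R' * P" "P\<^sup>T * R" f])
    have T: "(P\<^sup>T * R)\<^sup>T = R * P" using R P by (simp add: transpose RT)
    show "R' * P \<in> carrier_mat n n" "P\<^sup>T * R \<in> carrier_mat n n" using R P by auto
    show "R' * P * (P\<^sup>T * R) = 1\<^sub>m n" "P\<^sup>T * R * (R' * P) = 1\<^sub>m n"
      using R P PT RR by (simp_all add: assoc P1 RR1)
    show "A = (P\<^sup>T * R)\<^sup>T * mat_diag n f * (P\<^sup>T * R)"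
      unfolding T using R P PT F by (subst AX) (simp add: XP F_def [symmetric] assoc)
    show "mat_inv (diag_part A) * A = R' * P * mat_diag n f * (P\<^sup>T * R)"
      unfolding R'R' using R P PT F X by (subst AX) (simp add: XP F_def [symmetric] assoc RR1)
    \<comment> \<open>Orthogonal factors preserve the Euclidean norm, so only \<open>R\<close>
      contributes to the bounds for \<open>W\<close> and its transpose.\<close>
    show "eucl_norm (P\<^sup>T * R *\<^sub>v x) \<le> sqrt (spectral_norm A) * eucl_norm x" if "x \<in> carrier_vec n" for x
      using eucl_norm_isometry [OF PT, of "R *\<^sub>v x"] Rle [OF that] R P that
      by (simp add: assoc_mult_mat_vec [of _ n n _ n])
    show "eucl_norm ((P\<^sup>T * R)\<^sup>T *\<^sub>v x) \<le> sqrt (spectral_norm A) * eucl_norm x" if "x \<in> carrier_vec n" for x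
      using eucl_norm_isometry [OF P(1,2) that] Rle [of "P *\<^sub>v x"] R P that
      unfolding T by (simp add: assoc_mult_mat_vec [of _ n n _ n])
  qed
qed

text \<open>The spectral radius is taken over the complex numbers, so the real eigenvector is
  embedded there. Being nonzero, it also forces \<open>0 < n\<close>, which the maximality of the
  spectral radius requires.\<close>

lemma abs_eigenvalue_le_real_spectral_radius:
  assumes M: "M \<in> carrier_mat n n" and v: "v \<in> carrier_vec n" "v \<noteq> 0\<^sub>v n" "M *\<^sub>v v = e \<cdot>\<^sub>v v"
  shows "\<bar>e\<bar> \<le> real_spectral_radius M"
proof -
  let ?C = "map_mat complex_of_real M" and ?w = "map_vec complex_of_real v"
  have "?C *\<^sub>v ?w = map_vec complex_of_real (M *\<^sub>v v)"
    by (rule of_real_hom.mult_mat_vec_hom [OF M v(1), symmetric])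
  also have "\<dots> = complex_of_real e \<cdot>\<^sub>v ?w" unfolding v(3) by auto
  finally have "eigenvector ?C ?w (complex_of_real e)"
    using v(1,2) M by (auto simp: eigenvector_def vec_eq_iff)
  then have e: "complex_of_real e \<in> spectrum ?C" by (auto simp: spectrum_def eigenvalue_def)
  have n: "0 < n" using v(1,2) by (cases n) auto
  have "norm (complex_of_real e) \<in> norm ` spectrum ?C" using e by (rule imageI)
  from spectral_radius_mem_max(2) [OF _ n this] M show ?thesis
    by (simp add: real_spectral_radius_def)
qed

section \<open>The smoothing estimate\<close>

lemma damped_jacobi_smoothing:
  assumes spd: "sym_pos_def_mat A"
    and \<omega>: "0 < \<omega>" "\<omega> \<le> inverse (real_spectral_radius (mat_inv (diag_part A) * A))"
    and \<nu>: "1 \<le> \<nu>"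
  shows "spectral_norm (A * damped_jacobi \<omega> A ^\<^sub>m \<nu>) \<le> 1 / (2 * \<omega> * (real \<nu> + 1)) * spectral_norm A"
proof -
  define n where "n = dim_row A"
  have A: "A \<in> carrier_mat n n" using spd by (auto simp: n_def sym_pos_def_mat_def)
  note assoc = assoc_mult_mat [of _ n n _ n _ n]
  obtain V W f where VW: "V \<in> carrier_mat n n" "W \<in> carrier_mat n n" "V * W = 1\<^sub>m n" "W * V = 1\<^sub>m n"
    and AW: "A = W\<^sup>T * mat_diag n f * W" and DA: "mat_inv (diag_part A) * A = V * mat_diag n f * W"
    and W: "\<And>x. x \<in> carrier_vec n \<Longrightarrow> eucl_norm (W *\<^sub>v x) \<le> sqrt (spectral_norm A) * eucl_norm x"
    and WT: "\<And>x. x \<in> carrier_vec n \<Longrightarrow> eucl_norm (W\<^sup>T *\<^sub>v x) \<le> sqrt (spectral_norm A) * eucl_norm x"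
    by (rule simultaneous_diagonalization [OF spd A]) blast
  have VW1: "W * (V * M) = M" "V * (W * M) = M" if "M \<in> carrier_mat n n" for M
    using that VW by (simp_all add: assoc [symmetric])
  have WTc: "W\<^sup>T \<in> carrier_mat n n" using VW by simp
  have f: "0 < f i" "\<omega> * f i \<le> 1" if i: "i < n" for i
  proof -
    \<comment> \<open>Column \<open>i\<close> of \<open>V\<close> is an eigenvector of D^(-1) A for
      \<open>f i\<close>, which bounds \<open>f i\<close> by the spectral radius. The quadratic form
      of \<open>A\<close> at \<open>w\<close> also equals \<open>f i\<close>, which makes it
      positive.\<close>
    define w where "w = V *\<^sub>v unit_vec n i"
    have w: "w \<in> carrier_vec n" using VW by (simp add: w_def)
    have Ww: "W *\<^sub>v w = unit_vec n i"
      unfolding w_def using VW by (simp add: assoc_mult_mat_vec [of _ n n _ n, symmetric])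
    have w0: "w \<noteq> 0\<^sub>v n"
    proof
      assume "w = 0\<^sub>v n"
      then have "(W *\<^sub>v w) $ i = 0" using VW(2) i by simp
      then show False unfolding Ww using i by simp
    qed
    have fe: "mat_diag n f *\<^sub>v unit_vec n i = f i \<cdot>\<^sub>v unit_vec n i"
      using i by (intro eq_vecI) (auto simp: mat_diag_def)
    have "V * mat_diag n f * W *\<^sub>v w = V *\<^sub>v (mat_diag n f *\<^sub>v (W *\<^sub>v w))"
      using VW w by (simp add: assoc_mult_mat_vec [of _ n n _ n])
    also have "\<dots> = f i \<cdot>\<^sub>v w"
      unfolding Ww fe unfolding w_def using VW(1) by (intro mult_mat_vec) auto
    finally have "\<bar>f i\<bar> \<le> real_spectral_radius (mat_inv (diag_part A) * A)"
      unfolding DA using VW w w0 by (intro abs_eigenvalue_le_real_spectral_radius) auto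
    have "0 < w \<bullet> (A *\<^sub>v w)" by (rule sym_pos_def_matD [OF spd A w w0])
    also have "A *\<^sub>v w = W\<^sup>T *\<^sub>v (mat_diag n f *\<^sub>v (W *\<^sub>v w))"
      using VW w by (subst AW) (simp add: assoc_mult_mat_vec [of _ n n _ n])
    also have "w \<bullet> \<dots> = (W *\<^sub>v w) \<bullet> (mat_diag n f *\<^sub>v (W *\<^sub>v w))"
      using VW w scalar_prod_mult_mat_vec [OF WTc w, of "mat_diag n f *\<^sub>v (W *\<^sub>v w)"]
      by (simp add: mult_mat_vec_carrier [of _ n n])
    also have "\<dots> = f i" unfolding Ww fe using i by simp
    finally show f0: "0 < f i" .
    let ?\<rho> = "real_spectral_radius (mat_inv (diag_part A) * A)"
    have "f i \<le> ?\<rho>" using \<open>\<bar>f i\<bar> \<le> ?\<rho>\<close> by simp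
    then have "\<omega> * f i \<le> inverse ?\<rho> * ?\<rho>" using \<omega> f0 by (intro mult_mono) auto
    \<comment> \<open>The spectral radius is at least \<open>f i > 0\<close>, so its inverse is
      genuine and not the default value 0.\<close>
    also have "\<dots> = 1" using \<open>f i \<le> ?\<rho>\<close> f0 by simp
    finally show "\<omega> * f i \<le> 1" .
  qed
  define E where "E = mat_diag n (\<lambda>i. 1 - \<omega> * f i)"
  \<comment> \<open>Writing the identity as \<open>V * W\<close> puts both terms of the iteration
    matrix into the same eigenbasis.\<close>
  have S: "damped_jacobi \<omega> A = V * E * W"
  proof -
    have "E = 1\<^sub>m n - \<omega> \<cdot>\<^sub>m mat_diag n f"
      unfolding E_def by (rule eq_matI) (auto simp: mat_diag_def)
    then have "V * E * W = V * (1\<^sub>m n) * W - V * (\<omega> \<cdot>\<^sub>m mat_diag n f) * W"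
      using VW by (simp add: mult_minus_distrib_mat [of _ n n _ n] minus_mult_distrib_mat [of _ n n _ _ n])
    also have "\<dots> = 1\<^sub>m n - \<omega> \<cdot>\<^sub>m (V * mat_diag n f * W)"
      using VW by (simp add: mult_smult_distrib [of _ n n _ n] mult_smult_assoc_mat [of _ n n _ n])
    finally show ?thesis unfolding damped_jacobi_def DA n_def [symmetric] by simp
  qed
  have "similar_mat_wit (damped_jacobi \<omega> A) E V W"
    using VW by (intro similar_mat_witI [of _ _ n]) (auto simp: S E_def)
  then have Spow: "damped_jacobi \<omega> A ^\<^sub>m \<nu> = V * E ^\<^sub>m \<nu> * W"
    by (rule similar_mat_wit_pow_id)
  define g where "g i = f i * (1 - \<omega> * f i) ^ \<nu>" for i
  \<comment> \<open>The inner product \<open>W * V\<close> cancels, so the congruence form of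
    \<open>A\<close> and the similarity form of the power fit together, and the diagonal factors
    multiply entrywise to \<open>g\<close>.\<close>
  have eq: "A * damped_jacobi \<omega> A ^\<^sub>m \<nu> = W\<^sup>T * mat_diag n g * W"
  proof -
    define F where "F = mat_diag n f"
    have F: "F \<in> carrier_mat n n" by (simp add: F_def)
    define K where "K = E ^\<^sub>m \<nu>"
    have K: "K \<in> carrier_mat n n" by (simp add: K_def E_def mat_diag_power)
    have FK: "F * K = mat_diag n g" by (simp add: F_def K_def E_def mat_diag_power g_def [abs_def])
    have "A * damped_jacobi \<omega> A ^\<^sub>m \<nu> = W\<^sup>T * (F * K) * W"
      unfolding Spow K_def [symmetric] using VW WTc F K
      by (subst AW) (simp add: F_def [symmetric] assoc VW1)
    then show ?thesis unfolding FK .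
  qed
  let ?c = "1 / (2 * \<omega> * (real \<nu> + 1))" and ?s = "sqrt (spectral_norm A)"
  have c: "0 \<le> ?c" using \<omega> by simp
  have g: "\<bar>g i\<bar> \<le> ?c" if "i < n" for i
  proof -
    \<comment> \<open>The scalar estimate is used at \<open>t = \<omega> * f i\<close>; division by
      \<omega> then turns its left-hand side into \<open>g i\<close>.\<close>
    have "\<omega> * f i * (1 - \<omega> * f i) ^ \<nu> \<le> 1 / (2 * (real \<nu> + 1))"
      using f [OF that] \<omega> \<nu> by (intro mult_one_minus_power_le) auto
    then have "\<omega> * f i * (1 - \<omega> * f i) ^ \<nu> / \<omega> \<le> 1 / (2 * (real \<nu> + 1)) / \<omega>"
      using \<omega> by (intro divide_right_mono) auto
    also have "1 / (2 * (real \<nu> + 1)) / \<omega> = ?c" by (simp add: mult.commute mult.left_commute)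
    finally have "g i \<le> ?c" using \<omega> by (simp add: g_def)
    moreover have "0 \<le> g i" using f [OF that] by (simp add: g_def)
    ultimately show ?thesis by simp
  qed
  have N: "0 \<le> spectral_norm A" by (rule spectral_norm_nonneg)
  show ?thesis
  proof (rule spectral_norm_le)
    show "0 \<le> ?c * spectral_norm A" using c N by (intro mult_nonneg_nonneg)
    fix x :: "real vec" assume "x \<in> carrier_vec (dim_col (A * damped_jacobi \<omega> A ^\<^sub>m \<nu>))"
    then have x: "x \<in> carrier_vec n" using VW unfolding eq by simp
    have Wx: "W *\<^sub>v x \<in> carrier_vec n" "mat_diag n g *\<^sub>v (W *\<^sub>v x) \<in> carrier_vec n"
      using VW x by (auto intro!: mult_mat_vec_carrier [of _ n n])
    \<comment> \<open>\<open>W\<close> and its transpose cost a factor \<open>?s\<close> each and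
      the diagonal matrix a factor \<open>?c\<close>; the two square roots multiply to the spectral
      norm of \<open>A\<close>.\<close>
    have "eucl_norm (A * damped_jacobi \<omega> A ^\<^sub>m \<nu> *\<^sub>v x) = eucl_norm (W\<^sup>T *\<^sub>v (mat_diag n g *\<^sub>v (W *\<^sub>v x)))"
      unfolding eq using VW x by (simp add: assoc_mult_mat_vec [of _ n n _ n])
    also have "\<dots> \<le> ?s * eucl_norm (mat_diag n g *\<^sub>v (W *\<^sub>v x))" by (rule WT [OF Wx(2)])
    also have "\<dots> \<le> ?s * (?c * eucl_norm (W *\<^sub>v x))"
      using N by (intro mult_left_mono eucl_norm_mat_diag_le [OF Wx(1) g c]) auto
    also have "\<dots> \<le> ?s * (?c * (?s * eucl_norm x))"
      using N c by (intro mult_left_mono W [OF x]) auto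
    also have "\<dots> = ?c * (?s * ?s) * eucl_norm x" by (simp only: mult_ac)
    also have "?s * ?s = spectral_norm A" using N by simp
    finally show "eucl_norm (A * damped_jacobi \<omega> A ^\<^sub>m \<nu> *\<^sub>v x) \<le> ?c * spectral_norm A * eucl_norm x" .
  qed
qed

theorem theorem3p6:
  fixes I :: "'p set"
    and A :: "nat \<Rightarrow> 'p \<Rightarrow> real mat"
    and \<omega> :: "'p \<Rightarrow> real"
  assumes "finite I"
    and "\<And>l p. p \<in> I \<Longrightarrow> sym_pos_def_mat (A l p)"
    and "\<And>l p. p \<in> I \<Longrightarrow>
           \<omega> p \<in> {0 <.. inverse (real_spectral_radius (mat_inv (diag_part (A l p)) * A l p))}"
  shows "\<forall>p \<in> I. \<forall>l. \<forall>\<nu> \<ge> 1.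
           spectral_norm (A l p * damped_jacobi (\<omega> p) (A l p) ^\<^sub>m \<nu>)
             \<le> 1 / (2 * \<omega> p * (real \<nu> + 1)) * spectral_norm (A l p)"
proof (intro ballI allI impI)
  fix p l and \<nu> :: nat
  assume p: "p \<in> I" and "1 \<le> \<nu>"
  then show "spectral_norm (A l p * damped_jacobi (\<omega> p) (A l p) ^\<^sub>m \<nu>)
      \<le> 1 / (2 * \<omega> p * (real \<nu> + 1)) * spectral_norm (A l p)"
    using assms(2) [OF p, of l] assms(3) [OF p, of l] by (intro damped_jacobi_smoothing) auto
qed

end
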